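(* Let $(X,d,\preceq)$ be an ordered metric space, $F:X^n\to X$ a mapping and $\ast\in\mathfrak B_n$. Let $E$ be an $\underline{\mathrm O}$-complete subspace of $X$ such that $F(X^n)\subseteq E$. Suppose that the following conditions hold: (i) $F$ has the monotone property; (ii) either $F$ is $\underline{\mathrm O}$-continuous or $(E,d,\preceq)$ has the DCL property; (iii$'$) there exist $x^{(0)}_1,\dots,x^{(0)}_n\in X$ such that $x^{(0)}_i\succeq F(x^{(0)}_{i_1},x^{(0)}_{i_2},\dots,x^{(0)}_{i_n})$ for each $i\in I_n$; (iv) there exists $\varphi\in\Omega$ such that $$\frac1n\sum_{i=1}^n d\big(F(x_{i_1},\dots,x_{i_n}),F(y_{i_1},\dots,y_{i_n})\big)\le\varphi\Big(\frac1n\sum_{i=1}^n d(x_i,y_i)\Big)$$ for all $x_1,\dots,x_n,y_1,\dots,y_n\in X$ with [$x_i\preceq y_i$ for each $i\in I_n$] or [$x_i\succeq y_i$ for each $i\in I_n$]; or, alternatively to (iv), (iv$'$) there exists $\varphi\in\Omega$ such that $$\max_{i\in I_n} d\big(F(x_{i_1},\dots,x_{i_n}),F(y_{i_1},\dots,y_{i_n})\big)\le\varphi\Big(\max_{i\in I_n} d(x_i,y_i)\Big)$$ for all $x_1,\dots,x_n,y_1,\dots,y_n\in X$ with [$x_i\preceq y_i$ for each $i\in I_n$] or [$x_i\succeq y_i$ for each $i\in I_n$]. Then $F$ has an $\ast$-fixed point.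
   Context: Throughout, $n\ge 2$ is a fixed integer, $I_n=\{1,\dots,n\}$, and sequences are indexed by $m\in\mathbb N_0$. An ordered metric space $(X,d,\preceq)$ is a nonempty set $X$ with a metric $d$ and a partial order $\preceq$; $x\succeq y$ means $y\preceq x$. A subspace is a nonempty subset with the restricted metric and order. $\mathfrak B_n$ is the set of all binary operations $\ast:I_n\times I_n\to I_n$; for $\ast\in\mathfrak B_n$ write $i_k:=\ast(i,k)$. A sequence $\{x^{(m)}\}$ is decreasing if $x^{(m)}\succeq x^{(m+1)}$ for all $m$. $x^{(m)}\downarrow x$ means that $\{x^{(m)}\}$ is decreasing and converges to $x$ in $d$. $E$ is $\underline{\mathrm O}$-complete if every decreasing Cauchy sequence in $E$ converges in $E$. $F$ is $\underline{\mathrm O}$-continuous if for every $(x_1,\dots,x_n)\in X^n$ and all sequences $\{x_1^{(m)}\},\dots,\{x_n^{(m)}\}$ in $X$ with $x_i^{(m)}\downarrow x_i$ for each $i$, one has $F(x_1^{(m)},\dots,x_n^{(m)})\to F(x_1,\dots,x_n)$. $(E,d,\preceq)$ has the DCL property if for every sequence $\{x^{(m)}\}$ in $E$ and $x\in E$ with $x^{(m)}\downarrow x$, one has $x^{(m)}\succeq x$ for all $m$. $F$ has the monotone property if, for all $x_1,\dots,x_n,y_1,\dots,y_n\in X$, $x_i\preceq y_i$ for all $i\in I_n$ implies $F(x_1,\dots,x_n)\preceq F(y_1,\dots,y_n)$. $\Omega$ is the set of functions $\varphi:[0,\infty)\to[0,\infty)$ with $\varphi(t)<t$ and $\limsup_{r\to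 t^+}\varphi(r)<t$ for each $t>0$. $(x_1,\dots,x_n)\in X^n$ is an $\ast$-fixed point of $F$ if $F(x_{i_1},\dots,x_{i_n})=x_i$ for each $i\in I_n$. *)

theory Defs
  imports "HOL-Analysis.Analysis"
begin

text \<open>
  As with \<^locale>\<open>Metric_space\<close>, the space lives on a carrier set \<open>X\<close>; the order is a predicate of
  which only the restriction to \<open>X\<close> matters. A subspace \<open>E\<close> of \<open>X\<close> with the restricted metric
  and order is therefore the same locale at the carrier \<open>E\<close>, with unchanged \<open>d\<close> and \<open>\<preceq>\<close>.
\<close>

locale ordered_metric_space = Metric_space X d
  for X :: "'a set" and d :: "'a \<Rightarrow> 'a \<Rightarrow> real" +
  fixes leq :: "'a \<Rightarrow> 'a \<Rightarrow> bool" (infix "\<preceq>" 50)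
  assumes nonempty: "X \<noteq> {}"
    and order_refl: "reflp_on X (\<preceq>)"
    and order_trans: "transp_on X (\<preceq>)"
    and order_antisym: "antisymp_on X (\<preceq>)"
begin

definition decreasing :: "(nat \<Rightarrow> 'a) \<Rightarrow> bool"
  where "decreasing s \<longleftrightarrow> (\<forall>m. s (Suc m) \<preceq> s m)"

text \<open>\<^const>\<open>limitin\<close> constrains a sequence only eventually, so membership of all terms is explicit.\<close>

definition decreases_to :: "(nat \<Rightarrow> 'a) \<Rightarrow> 'a \<Rightarrow> bool"
  where "decreases_to s x \<longleftrightarrow>
    range s \<subseteq> X \<and> decreasing s \<and> limitin mtopology s x sequentially"

definition O_complete :: bool
  where "O_complete \<longleftrightarrow>
    (\<forall>s. decreasing s \<and> MCauchy s \<longrightarrow> (\<exists>x. limitin mtopology s x sequentially))"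

definition DCL_property :: bool
  where "DCL_property \<longleftrightarrow> (\<forall>s x. decreases_to s x \<longrightarrow> (\<forall>m. x \<preceq> s m))"

text \<open>An \<open>n\<close>-tuple over \<open>X\<close> is an extensional function in \<open>{1..n} \<rightarrow>\<^sub>E X\<close>.\<close>

definition O_continuous :: "nat \<Rightarrow> ((nat \<Rightarrow> 'a) \<Rightarrow> 'a) \<Rightarrow> bool"
  where "O_continuous n F \<longleftrightarrow>
    (\<forall>x \<in> {1..n} \<rightarrow>\<^sub>E X. \<forall>s :: nat \<Rightarrow> nat \<Rightarrow> 'a.
       (\<forall>i\<in>{1..n}. decreases_to (s i) (x i)) \<longrightarrow>
       limitin mtopology (\<lambda>m. F (\<lambda>i\<in>{1..n}. s i m)) (F x) sequentially)"

definition tuple_leq :: "nat \<Rightarrow> (nat \<Rightarrow> 'a) \<Rightarrow> (nat \<Rightarrow> 'a) \<Rightarrow> bool"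
  where "tuple_leq n x y \<longleftrightarrow> (\<forall>i\<in>{1..n}. x i \<preceq> y i)"

definition monotone_property :: "nat \<Rightarrow> ((nat \<Rightarrow> 'a) \<Rightarrow> 'a) \<Rightarrow> bool"
  where "monotone_property n F \<longleftrightarrow>
    (\<forall>x \<in> {1..n} \<rightarrow>\<^sub>E X. \<forall>y \<in> {1..n} \<rightarrow>\<^sub>E X. tuple_leq n x y \<longrightarrow> F x \<preceq> F y)"

lemma subspace: "E \<subseteq> X \<Longrightarrow> E \<noteq> {} \<Longrightarrow> ordered_metric_space E d (\<preceq>)"
  using Metric_space.subspace[OF Metric_space_axioms] order_refl order_trans order_antisym
  by (auto simp: ordered_metric_space_def ordered_metric_space_axioms_def
      intro: reflp_on_subset transp_on_subset antisymp_on_subset)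

end

definition binary_operations :: "nat \<Rightarrow> (nat \<Rightarrow> nat \<Rightarrow> nat) set"
  where "binary_operations n = {1..n} \<rightarrow> {1..n} \<rightarrow> {1..n}"

text \<open>The tuple \<open>(x\<^bsub>star i 1\<^esub>, \<dots>, x\<^bsub>star i n\<^esub>)\<close>.\<close>

definition star_tuple ::
    "nat \<Rightarrow> (nat \<Rightarrow> nat \<Rightarrow> nat) \<Rightarrow> (nat \<Rightarrow> 'a) \<Rightarrow> nat \<Rightarrow> (nat \<Rightarrow> 'a)"
  where "star_tuple n star x i = (\<lambda>k\<in>{1..n}. x (star i k))"

definition star_fixed_point ::
    "nat \<Rightarrow> (nat \<Rightarrow> nat \<Rightarrow> nat) \<Rightarrow> ((nat \<Rightarrow> 'a) \<Rightarrow> 'a) \<Rightarrow> (nat \<Rightarrow> 'a) \<Rightarrow> bool"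
  where "star_fixed_point n star F x \<longleftrightarrow> (\<forall>i\<in>{1..n}. F (star_tuple n star x i) = x i)"

text \<open>Functions on \<open>[0,\<infinity>)\<close>, with arbitrary values at negative arguments. The upper limit is
  taken in \<^typ>\<open>ereal\<close>, where it always exists.\<close>

definition Omega :: "(real \<Rightarrow> real) set"
  where "Omega = {\<phi>. \<phi> \<in> {0..} \<rightarrow> {0..} \<and>
    (\<forall>t>0. \<phi> t < t \<and> Limsup (at_right t) (\<lambda>r. ereal (\<phi> r)) < ereal t)}"

end

theory Submission
  imports Defs
begin

text \<open>
  An \<open>n\<close>-variable fixed point problem becomes an ordinary one on the space of tuples: a tuple is a
  star-fixed point of \<open>F\<close> exactly when it is fixed by the self-map \<open>\<Phi>\<close> of \<open>X\<^sup>n\<close> whose \<open>i\<close>-th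
  coordinate is \<open>F (x\<^bsub>star i 1\<^esub>, \<dots>, x\<^bsub>star i n\<^esub>)\<close>. For the coordinatewise order, monotonicity of
  \<open>F\<close> makes \<open>\<Phi>\<close> monotone, and the starting tuple satisfies \<open>\<Phi> x0 \<preceq> x0\<close>. The two alternative
  contraction hypotheses both say that \<open>\<Phi>\<close> contracts distances between comparable tuples through
  \<open>\<phi>\<close>; they differ only in the metric on \<open>X\<^sup>n\<close>, the mean or the maximum of the coordinate
  distances. Either metric bounds each coordinate distance up to the factor \<open>n\<close> and is bounded by
  the sum of them, so convergence and Cauchy sequences are coordinatewise, and the completeness,
  continuity and closedness hypotheses pass from \<open>X\<close> and \<open>E\<close> to tuples. The locale
  \<open>tuple_metric\<close> collects these two bounds and treats both metrics at once.

  It remains to find a fixed point of one monotone order contraction \<open>T\<close>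
  (\<open>order_contraction_fixed_point\<close>). The orbit of \<open>x0\<close> is decreasing, so any two of its members are
  comparable and the contraction applies to all of them. The condition on \<open>\<phi>\<close> means that near each
  \<open>t > 0\<close>, from the right and at \<open>t\<close> itself, the values of \<open>\<phi>\<close> stay below some number less than
  \<open>t\<close> (\<open>Omega_gap\<close>). This drives the step lengths of the orbit to zero, and traps a whole tail of
  the orbit near each of its members (\<open>order_contraction_orbit_MCauchy\<close>). The limit \<open>z\<close> exists by
  completeness; it is fixed because \<open>T\<close> maps the orbit to a sequence converging to \<open>T z\<close>,
  either by continuity, or because \<open>z\<close> lies below the orbit and \<open>T\<close> does not expand distances
  between comparable points.
\<close>

section \<open>Comparison functions\<close>

text \<open>
  The upper limit controls \<open>\<phi>\<close> only strictly to the right of \<open>t\<close>; together with \<open>\<phi> t < t\<close> it gives a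
  uniform bound on a half-open interval that includes \<open>t\<close>.
\<close>

lemma Omega_gap:
  assumes phi: "\<phi> \<in> Omega" and t: "t > 0"
  obtains q \<delta> where "q < t" "\<delta> > 0" "\<And>r. t \<le> r \<Longrightarrow> r < t + \<delta> \<Longrightarrow> \<phi> r \<le> q"
proof -
  have lt: "\<phi> t < t" and ls: "Limsup (at_right t) (\<lambda>r. ereal (\<phi> r)) < ereal t"
    using phi t by (auto simp: Omega_def)
  obtain p where p: "Limsup (at_right t) (\<lambda>r. ereal (\<phi> r)) < ereal p" "p < t"
    using ereal_dense2[OF ls] by auto
  have "eventually (\<lambda>r. \<phi> r < p) (at_right t)"
    using Limsup_lessD[OF p(1)] by simp
  then obtain b where b: "b > t" "\<And>r. t < r \<Longrightarrow> r < b \<Longrightarrow> \<phi> r < p"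
    by (auto simp: eventually_at_right_field)
  show ?thesis
  proof (rule that[of "max p (\<phi> t)" "b - t"])
    fix r assume "t \<le> r" "r < t + (b - t)"
    then show "\<phi> r \<le> max p (\<phi> t)"
      using b(2)[of r] by (cases "r = t") auto
  qed (use lt p b in auto)
qed

text \<open>
  A positive limit \<open>l\<close> would be approached from above, where one step of \<open>\<phi>\<close> jumps below \<open>l\<close>.
  Monotonicity is a separate hypothesis because \<open>\<phi> 0\<close> may be positive.
\<close>

lemma Omega_iterates_tendsto_zero:
  fixes c :: "nat \<Rightarrow> real"
  assumes phi: "\<phi> \<in> Omega"
    and nonneg: "\<And>m. 0 \<le> c m" and dec: "\<And>m. c (Suc m) \<le> c m"
    and step: "\<And>m. c (Suc m) \<le> \<phi> (c m)"
  shows "c \<longlonglongrightarrow> 0"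
proof -
  obtain l where l: "c \<longlonglongrightarrow> l" "\<And>m. l \<le> c m"
    using decseq_convergent[of c 0] nonneg dec by (auto simp: decseq_SucI)
  have "l \<ge> 0"
    using LIMSEQ_le_const[OF l(1)] nonneg by auto
  moreover have False if "l > 0"
  proof -
    obtain q \<delta> where q: "q < l" "\<delta> > 0" "\<And>r. l \<le> r \<Longrightarrow> r < l + \<delta> \<Longrightarrow> \<phi> r \<le> q"
      using Omega_gap[OF phi \<open>l > 0\<close>] by blast
    have "eventually (\<lambda>m. c m < l + \<delta>) sequentially"
      using order_tendstoD(2)[OF l(1)] q(2) by auto
    then obtain m where "c m < l + \<delta>"
      by (auto simp: eventually_sequentially)
    then have "c (Suc m) \<le> q"
      using q(3)[of "c m"] l(2)[of m] step[of m] by linarith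
    then show False
      using l(2)[of "Suc m"] q(1) by linarith
  qed
  ultimately show ?thesis
    using l(1) by (cases "l = 0") auto
qed

section \<open>A fixed point theorem for one monotone self-map\<close>

context ordered_metric_space
begin

lemma decreasing_antimono:
  assumes s: "range s \<subseteq> X" "decreasing s" and "m \<le> k"
  shows "s k \<preceq> s m"
  using \<open>m \<le> k\<close>
proof (induction k rule: dec_induct)
  case base
  then show ?case
    using reflp_onD[OF order_refl] s(1) by auto
next
  case (step k)
  have "s (Suc k) \<preceq> s k"
    using s(2) by (simp add: decreasing_def)
  then show ?case
    using transp_onD[OF order_trans] step.IH s(1) by (meson rangeI subsetD)
qed

definition order_contraction :: "(real \<Rightarrow> real) \<Rightarrow> ('a \<Rightarrow> 'a) \<Rightarrow> bool"
  where "order_contraction \<phi> T \<longleftrightarrow>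
    (\<forall>x\<in>X. \<forall>y\<in>X. x \<preceq> y \<or> y \<preceq> x \<longrightarrow> d (T x) (T y) \<le> \<phi> (d x y))"

text \<open>
  The case \<open>x = y\<close> is separate because \<open>\<phi> 0\<close> may be positive, so that there the contraction
  inequality gives nothing.
\<close>

lemma order_contraction_nonexpansive:
  assumes "order_contraction \<phi> T" "\<phi> \<in> Omega" "T \<in> X \<rightarrow> X"
    and "x \<in> X" "y \<in> X" "x \<preceq> y \<or> y \<preceq> x"
  shows "d (T x) (T y) \<le> d x y"
proof (cases "x = y")
  case True
  then show ?thesis
    using assms by (auto simp: Pi_iff)
next
  case False
  then have "d x y > 0"
    using assms by (meson mdist_pos_eq)
  then have "\<phi> (d x y) < d x y"
    using assms(2) by (auto simp: Omega_def)
  moreover have "d (T x) (T y) \<le> \<phi> (d x y)"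
    using assms by (auto simp: order_contraction_def)
  ultimately show ?thesis by linarith
qed

text \<open>
  Once the steps of the orbit are short, a tail cannot leave a ball around any of its own
  members \<open>s m\<close>: from inside the radius \<open>\<epsilon> / 2\<close> a short step does not get far, and at a distance
  slightly beyond it one application of \<open>T\<close> contracts the distance to at most \<open>q < \<epsilon> / 2\<close>,
  while replacing \<open>s m\<close> by its image costs only one more short step.
\<close>

lemma order_contraction_orbit_MCauchy:
  assumes phi: "\<phi> \<in> Omega" and T: "T \<in> X \<rightarrow> X" "order_contraction \<phi> T"
    and s: "range s \<subseteq> X" "decreasing s" and orbit: "\<And>m. s (Suc m) = T (s m)"
  shows "MCauchy s"
proof -
  have sX: "s m \<in> X" for m
    using s(1) by auto
  have comparable: "s m \<preceq> s k \<or> s k \<preceq> s m" for m k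
    using decreasing_antimono[OF s] nat_le_linear by blast
  have contr: "d (s (Suc m)) (s (Suc k)) \<le> \<phi> (d (s m) (s k))" for m k
    using T(2) comparable[of m k] sX unfolding order_contraction_def orbit by blast
  define c where "c m = d (s m) (s (Suc m))" for m
  have "c (Suc m) \<le> c m" for m
    unfolding c_def
    using order_contraction_nonexpansive[OF T(2) phi T(1) sX sX comparable, of m "Suc m"]
    by (simp flip: orbit)
  then have c0: "c \<longlonglongrightarrow> 0"
    using contr by (intro Omega_iterates_tendsto_zero[OF phi]) (auto simp: c_def)
  have "\<exists>N. \<forall>m k. N \<le> m \<longrightarrow> N \<le> k \<longrightarrow> d (s m) (s k) < \<epsilon>" if "\<epsilon> > 0" for \<epsilon>
  proof -
    obtain q \<delta> where q: "q < \<epsilon> / 2" "\<delta> > 0"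
      and gap: "\<And>r. \<epsilon> / 2 \<le> r \<Longrightarrow> r < \<epsilon> / 2 + \<delta> \<Longrightarrow> \<phi> r \<le> q"
      using Omega_gap[OF phi half_gt_zero[OF \<open>\<epsilon> > 0\<close>]] by blast
    \<comment> \<open>A step shorter than each of the three bounds, respectively, keeps the final radius at most
      \<open>\<epsilon>\<close>, does not jump over the interval of length \<open>\<delta>\<close>, and uses up less than the gap
      between \<open>q\<close> and \<open>\<epsilon> / 2\<close>.\<close>
    define \<eta> where "\<eta> = min (\<epsilon> / 2) (min \<delta> (\<epsilon> / 2 - q))"
    have "\<eta> > 0"
      using that q by (simp add: \<eta>_def)
    then obtain N where N: "\<And>m. N \<le> m \<Longrightarrow> c m < \<eta>"
      using order_tendstoD(2)[OF c0] by (auto simp: eventually_sequentially)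
    have close: "d (s m) (s k) < \<epsilon> / 2 + \<eta>" if "N \<le> m" "m \<le> k" for m k
      using \<open>m \<le> k\<close>
    proof (induction k rule: dec_induct)
      case base
      then show ?case
        using \<open>\<epsilon> > 0\<close> \<open>\<eta> > 0\<close> sX by simp
    next
      case (step k)
      show ?case
      proof (cases "d (s m) (s k) < \<epsilon> / 2")
        case True
        have "d (s m) (s (Suc k)) \<le> d (s m) (s k) + c k"
          unfolding c_def using sX by (intro triangle)
        then show ?thesis
          using True N[of k] step \<open>N \<le> m\<close> by linarith
      next
        case False
        have "d (s m) (s (Suc k)) \<le> c m + d (s (Suc m)) (s (Suc k))"
          unfolding c_def using sX by (intro triangle)
        moreover have "\<phi> (d (s m) (s k)) \<le> q"
          using False step.IH by (intro gap) (auto simp: \<eta>_def)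
        moreover have "c m < \<epsilon> / 2 - q"
          using N[OF \<open>N \<le> m\<close>] by (simp add: \<eta>_def)
        ultimately show ?thesis
          using contr[of m k] \<open>\<eta> > 0\<close> by linarith
      qed
    qed
    have "d (s m) (s k) < \<epsilon>" if "N \<le> m" "N \<le> k" for m k
    proof -
      have "d (s m) (s k) < \<epsilon> / 2 + \<eta>"
        using close that nat_le_linear[of m k] commute by metis
      then show ?thesis
        by (simp add: \<eta>_def)
    qed
    then show ?thesis by blast
  qed
  then show ?thesis
    using s(1) by (simp add: MCauchy_def)
qed

text \<open>
  The orbit enters \<open>Z\<close> after one step, which is why completeness and closedness are asked of \<open>Z\<close>.
\<close>

theorem order_contraction_fixed_point:
  assumes phi: "\<phi> \<in> Omega" and T: "order_contraction \<phi> T" "T \<in> X \<rightarrow> Z"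
    and mono: "\<And>x y. x \<in> X \<Longrightarrow> y \<in> X \<Longrightarrow> x \<preceq> y \<Longrightarrow> T x \<preceq> T y"
    and Z: "Z \<subseteq> X" "ordered_metric_space.O_complete Z d (\<preceq>)"
    and start: "x0 \<in> X" "T x0 \<preceq> x0"
    and cont: "(\<forall>s x. decreases_to s x \<longrightarrow> limitin mtopology (\<lambda>m. T (s m)) (T x) sequentially) \<or>
      ordered_metric_space.DCL_property Z d (\<preceq>)"
  shows "\<exists>x\<in>X. T x = x"
proof -
  have "T x0 \<in> Z"
    using T(2) start by auto
  then interpret Z: ordered_metric_space Z d "(\<preceq>)"
    by (intro subspace[OF Z(1)]) blast
  have TX: "T \<in> X \<rightarrow> X"
    using T(2) Z(1) by auto
  \<comment> \<open>The orbit starts at \<open>T x0\<close>, since \<open>x0\<close> itself may lie outside \<open>Z\<close>.\<close>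
  define s where "s m = (T ^^ Suc m) x0" for m
  have orbit: "s (Suc m) = T (s m)" for m
    by (simp add: s_def)
  have sZ: "s m \<in> Z" for m
    by (induction m) (use T(2) start Z(1) in \<open>auto simp: s_def\<close>)
  then have sX: "s m \<in> X" for m
    using Z(1) by auto
  have down: "s (Suc m) \<preceq> s m" for m
  proof (induction m)
    case 0
    show ?case
      using mono[of "T x0" x0] start TX by (auto simp: s_def)
  next
    case (Suc m)
    then show ?case
      using mono sX orbit by metis
  qed
  then have dec: "decreasing s" "Z.decreasing s"
    by (auto simp: decreasing_def Z.decreasing_def)
  have "MCauchy s"
    using order_contraction_orbit_MCauchy[OF phi TX T(1) _ dec(1) orbit] sX by auto
  then have "Z.MCauchy s"
    using sZ by (auto simp: MCauchy_def Z.MCauchy_def)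
  then obtain z where zZ: "limitin Z.mtopology s z sequentially"
    using Z(2) dec(2) by (auto simp: Z.O_complete_def)
  then have zX: "z \<in> Z" "z \<in> X" and dist0: "(\<lambda>m. d (s m) z) \<longlonglongrightarrow> 0"
    using Z(1) by (auto simp: Z.limitin_metric_dist_null)
  have lim: "limitin mtopology s z sequentially"
    using zX dist0 sX by (simp add: limitin_metric_dist_null)
  have "limitin mtopology (\<lambda>m. T (s m)) (T z) sequentially"
    using cont
  proof
    assume "\<forall>s x. decreases_to s x \<longrightarrow> limitin mtopology (\<lambda>m. T (s m)) (T x) sequentially"
    moreover have "decreases_to s z"
      using lim dec(1) sX by (auto simp: decreases_to_def)
    ultimately show ?thesis by blast
  next
    assume "Z.DCL_property"
    moreover have "Z.decreases_to s z"
      using zZ dec(2) sZ by (auto simp: Z.decreases_to_def)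
    ultimately have "z \<preceq> s m" for m
      by (auto simp: Z.DCL_property_def)
    then have "d (T (s m)) (T z) \<le> d (s m) z" for m
      using order_contraction_nonexpansive[OF T(1) phi TX sX zX(2)] by blast
    then have "(\<lambda>m. d (T (s m)) (T z)) \<longlonglongrightarrow> 0"
      by (intro tendsto_sandwich[OF _ _ tendsto_const dist0]) auto
    then show ?thesis
      using TX sX zX by (auto simp: limitin_metric_dist_null Pi_iff)
  qed
  moreover have "limitin mtopology (\<lambda>m. T (s m)) z sequentially"
    using limitin_sequentially_offset[OF lim, of 1] by (simp add: orbit)
  ultimately have "T z = z"
    using limitin_metric_unique by fastforce
  then show ?thesis
    using zX by blast
qed

end

section \<open>The ordered metric space of tuples\<close>

text \<open>
  The two bounds are what the mean and the maximum of the coordinate distances have in common.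
  They force \<open>D\<close> to induce coordinatewise convergence.
\<close>

locale tuple_metric = ordered_metric_space X d leq
  for X :: "'a set" and d and leq (infix "\<preceq>" 50) +
  fixes n :: nat and D :: "(nat \<Rightarrow> 'a) \<Rightarrow> (nat \<Rightarrow> 'a) \<Rightarrow> real"
  assumes D_metric: "Metric_space ({1..n} \<rightarrow>\<^sub>E X) D"
    and coordinate_le: "\<And>x y i. i \<in> {1..n} \<Longrightarrow> d (x i) (y i) \<le> real n * D x y"
    and le_sum: "\<And>x y. D x y \<le> (\<Sum>i=1..n. d (x i) (y i))"

sublocale tuple_metric \<subseteq> tuples: ordered_metric_space "{1..n} \<rightarrow>\<^sub>E X" D "tuple_leq n"
proof (intro ordered_metric_space.intro D_metric ordered_metric_space_axioms.intro)
  show "({1..n} \<rightarrow>\<^sub>E X) \<noteq> {}"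
    using nonempty by (simp add: PiE_eq_empty_iff)
  show "reflp_on ({1..n} \<rightarrow>\<^sub>E X) (tuple_leq n)"
    using reflp_onD[OF order_refl] by (auto intro!: reflp_onI simp: tuple_leq_def PiE_iff)
  show "transp_on ({1..n} \<rightarrow>\<^sub>E X) (tuple_leq n)"
  proof (rule transp_onI)
    fix x y z
    assume xyz: "x \<in> {1..n} \<rightarrow>\<^sub>E X" "y \<in> {1..n} \<rightarrow>\<^sub>E X" "z \<in> {1..n} \<rightarrow>\<^sub>E X"
      and le: "tuple_leq n x y" "tuple_leq n y z"
    have "x i \<preceq> z i" if "i \<in> {1..n}" for i
      using transp_onD[OF order_trans, of "x i" "y i" "z i"] xyz[THEN PiE_mem, OF that] le that
      by (simp add: tuple_leq_def)
    then show "tuple_leq n x z"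
      by (simp add: tuple_leq_def)
  qed
  show "antisymp_on ({1..n} \<rightarrow>\<^sub>E X) (tuple_leq n)"
  proof (rule antisymp_onI)
    fix x y
    assume xy: "x \<in> {1..n} \<rightarrow>\<^sub>E X" "y \<in> {1..n} \<rightarrow>\<^sub>E X"
      and le: "tuple_leq n x y" "tuple_leq n y x"
    show "x = y"
    proof (rule PiE_ext[OF xy])
      fix i assume "i \<in> {1..n}"
      then show "x i = y i"
        using antisymp_onD[OF order_antisym, of "x i" "y i"] xy[THEN PiE_mem] le
        by (simp add: tuple_leq_def)
    qed
  qed
qed

context tuple_metric
begin

lemma limitin_coordinatewise:
  assumes s: "\<And>m. s m \<in> {1..n} \<rightarrow>\<^sub>E X" and x: "x \<in> {1..n} \<rightarrow>\<^sub>E X"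
  shows "limitin tuples.mtopology s x sequentially \<longleftrightarrow>
    (\<forall>i\<in>{1..n}. limitin mtopology (\<lambda>m. s m i) (x i) sequentially)"
proof -
  have "(\<lambda>m. D (s m) x) \<longlonglongrightarrow> 0 \<longleftrightarrow> (\<forall>i\<in>{1..n}. (\<lambda>m. d (s m i) (x i)) \<longlonglongrightarrow> 0)"
  proof (intro iffI ballI)
    fix i assume i: "i \<in> {1..n}" and lim: "(\<lambda>m. D (s m) x) \<longlonglongrightarrow> 0"
    have bound: "(\<lambda>m. real n * D (s m) x) \<longlonglongrightarrow> 0"
      using tendsto_mult_left[OF lim, of "real n"] by simp
    show "(\<lambda>m. d (s m i) (x i)) \<longlonglongrightarrow> 0"
      by (rule tendsto_sandwich[OF _ _ tendsto_const bound]) (use coordinate_le[OF i] in auto)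
  next
    assume "\<forall>i\<in>{1..n}. (\<lambda>m. d (s m i) (x i)) \<longlonglongrightarrow> 0"
    then have "(\<lambda>m. \<Sum>i=1..n. d (s m i) (x i)) \<longlonglongrightarrow> (\<Sum>i=1..n. 0)"
      by (intro tendsto_sum) auto
    then have bound: "(\<lambda>m. \<Sum>i=1..n. d (s m i) (x i)) \<longlonglongrightarrow> 0"
      by simp
    show "(\<lambda>m. D (s m) x) \<longlonglongrightarrow> 0"
      by (rule tendsto_sandwich[OF _ _ tendsto_const bound]) (use le_sum in auto)
  qed
  then show ?thesis
    using s x PiE_mem[OF s] PiE_mem[OF x]
    unfolding limitin_metric_dist_null tuples.limitin_metric_dist_null by simp
qed

lemma decreases_to_coordinate:
  assumes "tuples.decreases_to s x" and i: "i \<in> {1..n}"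
  shows "decreases_to (\<lambda>m. s m i) (x i)"
proof -
  have s: "\<And>m. s m \<in> {1..n} \<rightarrow>\<^sub>E X" and x: "x \<in> {1..n} \<rightarrow>\<^sub>E X"
    using assms(1) tuples.limitin_mspace unfolding tuples.decreases_to_def by blast+
  have "limitin mtopology (\<lambda>m. s m i) (x i) sequentially"
    using assms(1) i limitin_coordinatewise[of s x] s x unfolding tuples.decreases_to_def by blast
  moreover have "decreasing (\<lambda>m. s m i)"
    using assms unfolding tuples.decreases_to_def tuples.decreasing_def decreasing_def tuple_leq_def
    by blast
  ultimately show ?thesis
    using PiE_mem[OF s i] by (auto simp: decreases_to_def)
qed

lemma DCL_property_tuples:
  assumes DCL_property
  shows tuples.DCL_property
  unfolding tuples.DCL_property_def
proof (intro allI impI)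
  fix s x m assume s: "tuples.decreases_to s x"
  show "tuple_leq n x (s m)"
    using assms decreases_to_coordinate[OF s] unfolding tuple_leq_def DCL_property_def by blast
qed

lemma O_complete_tuples:
  assumes O_complete
  shows tuples.O_complete
  unfolding tuples.O_complete_def
proof (intro allI impI, elim conjE)
  fix s assume dec: "tuples.decreasing s" and cau: "tuples.MCauchy s"
  have s: "s m \<in> {1..n} \<rightarrow>\<^sub>E X" for m
    using cau unfolding tuples.MCauchy_def by blast
  have "\<exists>x. limitin mtopology (\<lambda>m. s m i) x sequentially" if i: "i \<in> {1..n}" for i
  proof -
    have "n > 0"
      using i by auto
    have "\<exists>N. \<forall>m k. N \<le> m \<longrightarrow> N \<le> k \<longrightarrow> d (s m i) (s k i) < \<epsilon>" if "\<epsilon> > 0" for \<epsilon>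
    proof -
      have "\<epsilon> / real n > 0"
        using that \<open>n > 0\<close> by simp
      then obtain N where N: "\<And>m k. N \<le> m \<Longrightarrow> N \<le> k \<Longrightarrow> D (s m) (s k) < \<epsilon> / real n"
        using cau unfolding tuples.MCauchy_def by blast
      have "d (s m i) (s k i) < \<epsilon>" if "N \<le> m" "N \<le> k" for m k
        using N[OF that] coordinate_le[OF i, of "s m" "s k"] \<open>n > 0\<close>
        by (simp add: pos_less_divide_eq mult.commute)
      then show ?thesis by blast
    qed
    then have "MCauchy (\<lambda>m. s m i)"
      using PiE_mem[OF s i] by (auto simp: MCauchy_def)
    moreover have "decreasing (\<lambda>m. s m i)"
      using dec i unfolding tuples.decreasing_def decreasing_def tuple_leq_def by blast
    ultimately show ?thesis
      using assms by (auto simp: O_complete_def)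
  qed
  then obtain x where x: "\<And>i. i \<in> {1..n} \<Longrightarrow> limitin mtopology (\<lambda>m. s m i) (x i) sequentially"
    by metis
  then have "restrict x {1..n} \<in> {1..n} \<rightarrow>\<^sub>E X"
    using limitin_mspace by fastforce
  then show "\<exists>x. limitin tuples.mtopology s x sequentially"
    using x limitin_coordinatewise[of s "restrict x {1..n}"] s by auto
qed

end

definition mean_dist :: "nat \<Rightarrow> ('a \<Rightarrow> 'a \<Rightarrow> real) \<Rightarrow> (nat \<Rightarrow> 'a) \<Rightarrow> (nat \<Rightarrow> 'a) \<Rightarrow> real"
  where "mean_dist n d x y = 1 / real n * (\<Sum>i=1..n. d (x i) (y i))"

definition max_dist :: "nat \<Rightarrow> ('a \<Rightarrow> 'a \<Rightarrow> real) \<Rightarrow> (nat \<Rightarrow> 'a) \<Rightarrow> (nat \<Rightarrow> 'a) \<Rightarrow> real"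
  where "max_dist n d x y = (MAX i\<in>{1..n}. d (x i) (y i))"

context ordered_metric_space
begin

lemma tuple_metric_mean:
  assumes "n > 0"
  shows "tuple_metric X d (\<preceq>) n (mean_dist n d)"
proof unfold_locales
  fix x y z :: "nat \<Rightarrow> 'a"
  show "0 \<le> mean_dist n d x y"
    by (simp add: mean_dist_def sum_nonneg)
  show "mean_dist n d x y = mean_dist n d y x"
    by (simp add: mean_dist_def commute)
  show "mean_dist n d x y \<le> (\<Sum>i=1..n. d (x i) (y i))"
    using assms mult_left_mono[of 1 "real n" "\<Sum>i=1..n. d (x i) (y i)"]
    by (simp add: mean_dist_def divide_le_eq sum_nonneg)
  show "d (x i) (y i) \<le> real n * mean_dist n d x y" if "i \<in> {1..n}" for i
    using that assms member_le_sum[of i "{1..n}" "\<lambda>i. d (x i) (y i)"] by (simp add: mean_dist_def)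
  assume x: "x \<in> {1..n} \<rightarrow>\<^sub>E X" and y: "y \<in> {1..n} \<rightarrow>\<^sub>E X"
  have "mean_dist n d x y = 0 \<longleftrightarrow> (\<forall>i\<in>{1..n}. d (x i) (y i) = 0)"
    using assms by (simp add: mean_dist_def sum_nonneg_eq_0_iff)
  also have "\<dots> \<longleftrightarrow> (\<forall>i\<in>{1..n}. x i = y i)"
    using PiE_mem[OF x] PiE_mem[OF y] by simp
  finally show "mean_dist n d x y = 0 \<longleftrightarrow> x = y"
    using PiE_ext[OF x y] by auto
  assume z: "z \<in> {1..n} \<rightarrow>\<^sub>E X"
  have "(\<Sum>i=1..n. d (x i) (z i)) \<le> (\<Sum>i=1..n. d (x i) (y i) + d (y i) (z i))"
    by (intro sum_mono triangle PiE_mem[OF x] PiE_mem[OF y] PiE_mem[OF z])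
  then show "mean_dist n d x z \<le> mean_dist n d x y + mean_dist n d y z"
    by (simp add: mean_dist_def sum.distrib divide_right_mono flip: add_divide_distrib)
qed

lemma tuple_metric_max:
  assumes "n > 0"
  shows "tuple_metric X d (\<preceq>) n (max_dist n d)"
proof unfold_locales
  fix x y z :: "nat \<Rightarrow> 'a"
  have coord: "d (x i) (y i) \<le> max_dist n d x y" if "i \<in> {1..n}" for x y :: "nat \<Rightarrow> 'a" and i
    using that by (simp add: max_dist_def)
  have leI: "max_dist n d x y \<le> b" if "\<And>i. i \<in> {1..n} \<Longrightarrow> d (x i) (y i) \<le> b"
    for x y :: "nat \<Rightarrow> 'a" and b
    using that assms by (simp add: max_dist_def)
  have one: "1 \<in> {1..n}"
    using assms by auto
  show nn: "0 \<le> max_dist n d x y" for x y :: "nat \<Rightarrow> 'a"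
    using coord[OF one, of x y] nonneg[of "x 1" "y 1"] by linarith
  show "max_dist n d x y = max_dist n d y x"
    by (simp add: max_dist_def commute)
  show "max_dist n d x y \<le> (\<Sum>i=1..n. d (x i) (y i))"
    by (intro leI member_le_sum) auto
  show "d (x i) (y i) \<le> real n * max_dist n d x y" if "i \<in> {1..n}" for i
    using coord[OF that, of x y] mult_right_mono[of 1 "real n", OF _ nn[of x y]] assms by simp
  assume x: "x \<in> {1..n} \<rightarrow>\<^sub>E X" and y: "y \<in> {1..n} \<rightarrow>\<^sub>E X"
  have "max_dist n d x y = 0 \<longleftrightarrow> (\<forall>i\<in>{1..n}. d (x i) (y i) = 0)"
  proof (intro iffI ballI)
    fix i assume "max_dist n d x y = 0" "i \<in> {1..n}"
    then show "d (x i) (y i) = 0"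
      using coord[of i x y] nonneg[of "x i" "y i"] by linarith
  next
    assume "\<forall>i\<in>{1..n}. d (x i) (y i) = 0"
    then show "max_dist n d x y = 0"
      using leI[of x y 0] nn[of x y] by force
  qed
  also have "\<dots> \<longleftrightarrow> (\<forall>i\<in>{1..n}. x i = y i)"
    using PiE_mem[OF x] PiE_mem[OF y] by simp
  finally show "max_dist n d x y = 0 \<longleftrightarrow> x = y"
    using PiE_ext[OF x y] by auto
  assume z: "z \<in> {1..n} \<rightarrow>\<^sub>E X"
  show "max_dist n d x z \<le> max_dist n d x y + max_dist n d y z"
  proof (rule leI)
    fix i assume i: "i \<in> {1..n}"
    have "d (x i) (z i) \<le> d (x i) (y i) + d (y i) (z i)"
      using triangle PiE_mem[OF x i] PiE_mem[OF y i] PiE_mem[OF z i] .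
    then show "d (x i) (z i) \<le> max_dist n d x y + max_dist n d y z"
      using coord[OF i, of x y] coord[OF i, of y z] by linarith
  qed
qed

end

section \<open>Fixed points with respect to a binary operation\<close>

text \<open>Its fixed points among the tuples are the star-fixed points of \<open>F\<close>.\<close>

definition star_map :: "nat \<Rightarrow> (nat \<Rightarrow> nat \<Rightarrow> nat) \<Rightarrow> ((nat \<Rightarrow> 'a) \<Rightarrow> 'a) \<Rightarrow> (nat \<Rightarrow> 'a) \<Rightarrow> nat \<Rightarrow> 'a"
  where "star_map n star F x = (\<lambda>i\<in>{1..n}. F (star_tuple n star x i))"

lemma star_map_apply [simp]:
  "i \<in> {1..n} \<Longrightarrow> star_map n star F x i = F (star_tuple n star x i)"
  by (simp add: star_map_def)

lemma star_tuple_mem: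
  assumes "star \<in> binary_operations n" "x \<in> {1..n} \<rightarrow>\<^sub>E X" "i \<in> {1..n}"
  shows "star_tuple n star x i \<in> {1..n} \<rightarrow>\<^sub>E X"
proof -
  have "star i k \<in> {1..n}" if "k \<in> {1..n}" for k
    using assms(1,3) that unfolding binary_operations_def by blast
  then show ?thesis
    using PiE_mem[OF assms(2)] by (simp add: star_tuple_def)
qed

context tuple_metric
begin

text \<open>
  Selecting coordinates, possibly repeatedly, from a decreasing convergent sequence of tuples
  gives decreasing convergent coordinate sequences, to which the continuity of \<open>F\<close> applies.
\<close>

lemma star_map_continuous:
  assumes F: "F \<in> ({1..n} \<rightarrow>\<^sub>E X) \<rightarrow> X" "O_continuous n F" and star: "star \<in> binary_operations n"
    and s: "tuples.decreases_to s x"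
  shows "limitin tuples.mtopology (\<lambda>m. star_map n star F (s m)) (star_map n star F x) sequentially"
proof -
  have sX: "\<And>m. s m \<in> {1..n} \<rightarrow>\<^sub>E X" and x: "x \<in> {1..n} \<rightarrow>\<^sub>E X"
    using s tuples.limitin_mspace unfolding tuples.decreases_to_def by blast+
  have mem: "star_map n star F y \<in> {1..n} \<rightarrow>\<^sub>E X" if "y \<in> {1..n} \<rightarrow>\<^sub>E X" for y
    unfolding star_map_def using F(1) star_tuple_mem[OF star that]
    by (intro restrict_PiE_iff[THEN iffD2] ballI) blast
  have "limitin mtopology (\<lambda>m. F (star_tuple n star (s m) i)) (F (star_tuple n star x i)) sequentially"
    if i: "i \<in> {1..n}" for i
  proof -
    have "star i k \<in> {1..n}" if "k \<in> {1..n}" for k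
      using star i that unfolding binary_operations_def by blast
    then have "\<forall>k\<in>{1..n}. decreases_to (\<lambda>m. s m (star i k)) (star_tuple n star x i k)"
      using decreases_to_coordinate[OF s] by (simp add: star_tuple_def)
    then have "limitin mtopology (\<lambda>m. F (\<lambda>k\<in>{1..n}. s m (star i k))) (F (star_tuple n star x i)) sequentially"
      using F(2) star_tuple_mem[OF star x i] unfolding O_continuous_def
      by (auto dest!: bspec[of _ _ "star_tuple n star x i"] spec[of _ "\<lambda>k m. s m (star i k)"])
    then show ?thesis
      by (simp add: star_tuple_def)
  qed
  then show ?thesis
    using limitin_coordinatewise[OF mem[OF sX] mem[OF x]] by simp
qed

text \<open>
  The orbit argument runs in \<open>X\<^sup>n\<close> with \<open>Z = E\<^sup>n\<close>. Both bounds on \<open>D\<close> hold for all tuples, so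
  they hold over \<open>E\<close> as well, and the transfer of completeness and closedness from coordinates to
  tuples is available there.
\<close>

theorem star_fixed_point_exists:
  assumes F: "F \<in> ({1..n} \<rightarrow>\<^sub>E X) \<rightarrow> E" and star: "star \<in> binary_operations n"
    and E: "E \<subseteq> X" "E \<noteq> {}" "ordered_metric_space.O_complete E d (\<preceq>)"
    and mono: "monotone_property n F"
    and cont: "O_continuous n F \<or> ordered_metric_space.DCL_property E d (\<preceq>)"
    and start: "x0 \<in> {1..n} \<rightarrow>\<^sub>E X" "\<And>i. i \<in> {1..n} \<Longrightarrow> F (star_tuple n star x0 i) \<preceq> x0 i"
    and contr: "\<phi> \<in> Omega" "tuples.order_contraction \<phi> (star_map n star F)"
  shows "\<exists>x \<in> {1..n} \<rightarrow>\<^sub>E X. star_fixed_point n star F x"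
proof -
  interpret E: ordered_metric_space E d "(\<preceq>)"
    using E by (intro subspace)
  have sub: "({1..n} \<rightarrow>\<^sub>E E) \<subseteq> ({1..n} \<rightarrow>\<^sub>E X)"
    using E(1) by (intro PiE_mono)
  interpret E: tuple_metric E d "(\<preceq>)" n D
    by (intro tuple_metric.intro tuple_metric_axioms.intro E.ordered_metric_space_axioms
        Metric_space.subspace[OF D_metric sub] coordinate_le le_sum)
  have "\<exists>x \<in> {1..n} \<rightarrow>\<^sub>E X. star_map n star F x = x"
  proof (rule tuples.order_contraction_fixed_point[OF contr])
    show "star_map n star F \<in> ({1..n} \<rightarrow>\<^sub>E X) \<rightarrow> ({1..n} \<rightarrow>\<^sub>E E)"
    proof
      fix x assume x: "x \<in> {1..n} \<rightarrow>\<^sub>E X"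
      show "star_map n star F x \<in> {1..n} \<rightarrow>\<^sub>E E"
        unfolding star_map_def using F star_tuple_mem[OF star x]
        by (intro restrict_PiE_iff[THEN iffD2] ballI) blast
    qed
    show "({1..n} \<rightarrow>\<^sub>E E) \<subseteq> ({1..n} \<rightarrow>\<^sub>E X)"
      by fact
    show "ordered_metric_space.O_complete ({1..n} \<rightarrow>\<^sub>E E) D (tuple_leq n)"
      by (rule E.O_complete_tuples[OF E(3)])
    show "x0 \<in> {1..n} \<rightarrow>\<^sub>E X"
      by fact
    show "tuple_leq n (star_map n star F x0) x0"
      using start(2) by (simp add: tuple_leq_def)
    fix x y assume xy: "x \<in> {1..n} \<rightarrow>\<^sub>E X" "y \<in> {1..n} \<rightarrow>\<^sub>E X" "tuple_leq n x y"
    have "tuple_leq n (star_tuple n star x i) (star_tuple n star y i)" if "i \<in> {1..n}" for i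
    proof -
      have "star i k \<in> {1..n}" if "k \<in> {1..n}" for k
        using star \<open>i \<in> {1..n}\<close> that unfolding binary_operations_def by blast
      then show ?thesis
        using xy(3) by (simp add: tuple_leq_def star_tuple_def)
    qed
    then have "F (star_tuple n star x i) \<preceq> F (star_tuple n star y i)" if "i \<in> {1..n}" for i
      using mono star_tuple_mem[OF star xy(1) that] star_tuple_mem[OF star xy(2) that] that
      unfolding monotone_property_def by blast
    then show "tuple_leq n (star_map n star F x) (star_map n star F y)"
      by (simp add: tuple_leq_def)
  next
    have "F \<in> ({1..n} \<rightarrow>\<^sub>E X) \<rightarrow> X"
      using F E(1) by auto
    then show "(\<forall>s x. tuples.decreases_to s x \<longrightarrow>
        limitin tuples.mtopology (\<lambda>m. star_map n star F (s m)) (star_map n star F x) sequentially) \<or>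
      ordered_metric_space.DCL_property ({1..n} \<rightarrow>\<^sub>E E) D (tuple_leq n)"
      using cont star_map_continuous[OF _ _ star] E.DCL_property_tuples by blast
  qed
  then show ?thesis
    by (metis star_fixed_point_def star_map_apply)
qed

end

theorem theorem13:
  fixes X E :: "'a set" and d :: "'a \<Rightarrow> 'a \<Rightarrow> real" and leq :: "'a \<Rightarrow> 'a \<Rightarrow> bool"
    and n :: nat and F :: "(nat \<Rightarrow> 'a) \<Rightarrow> 'a" and star :: "nat \<Rightarrow> nat \<Rightarrow> nat"
  assumes "n \<ge> 2"
    and "ordered_metric_space X d leq"
    and "F \<in> ({1..n} \<rightarrow>\<^sub>E X) \<rightarrow> X"
    and "star \<in> binary_operations n"
    and "E \<subseteq> X" and "E \<noteq> {}"
    and "ordered_metric_space.O_complete E d leq"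
    and "F ` ({1..n} \<rightarrow>\<^sub>E X) \<subseteq> E"
    and i: "ordered_metric_space.monotone_property X leq n F"
    and ii: "ordered_metric_space.O_continuous X d leq n F \<or>
             ordered_metric_space.DCL_property E d leq"
    and iii': "\<exists>x0 \<in> {1..n} \<rightarrow>\<^sub>E X. \<forall>i\<in>{1..n}. leq (F (star_tuple n star x0 i)) (x0 i)"
    and iv_or_iv':
      "(\<exists>\<phi>\<in>Omega. \<forall>x \<in> {1..n} \<rightarrow>\<^sub>E X. \<forall>y \<in> {1..n} \<rightarrow>\<^sub>E X.
          ordered_metric_space.tuple_leq leq n x y \<or> ordered_metric_space.tuple_leq leq n y x \<longrightarrow>
          1 / real n * (\<Sum>i=1..n. d (F (star_tuple n star x i)) (F (star_tuple n star y i)))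
            \<le> \<phi> (1 / real n * (\<Sum>i=1..n. d (x i) (y i)))) \<or>
       (\<exists>\<phi>\<in>Omega. \<forall>x \<in> {1..n} \<rightarrow>\<^sub>E X. \<forall>y \<in> {1..n} \<rightarrow>\<^sub>E X.
          ordered_metric_space.tuple_leq leq n x y \<or> ordered_metric_space.tuple_leq leq n y x \<longrightarrow>
          (MAX i\<in>{1..n}. d (F (star_tuple n star x i)) (F (star_tuple n star y i)))
            \<le> \<phi> (MAX i\<in>{1..n}. d (x i) (y i)))"
  shows "\<exists>x \<in> {1..n} \<rightarrow>\<^sub>E X. star_fixed_point n star F x"
proof -
  interpret ordered_metric_space X d leq
    by fact
  have "n > 0"
    using \<open>n \<ge> 2\<close> by simp
  have FE: "F \<in> ({1..n} \<rightarrow>\<^sub>E X) \<rightarrow> E"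
    using assms(8) by blast
  obtain x0 where x0: "x0 \<in> {1..n} \<rightarrow>\<^sub>E X"
    "\<And>i. i \<in> {1..n} \<Longrightarrow> leq (F (star_tuple n star x0 i)) (x0 i)"
    using iii' by blast
  show ?thesis
    using iv_or_iv'
  proof (elim disjE bexE)
    fix \<phi> assume phi: "\<phi> \<in> Omega" and contr:
      "\<forall>x \<in> {1..n} \<rightarrow>\<^sub>E X. \<forall>y \<in> {1..n} \<rightarrow>\<^sub>E X. tuple_leq n x y \<or> tuple_leq n y x \<longrightarrow>
          1 / real n * (\<Sum>i=1..n. d (F (star_tuple n star x i)) (F (star_tuple n star y i)))
            \<le> \<phi> (1 / real n * (\<Sum>i=1..n. d (x i) (y i)))"
    interpret mean: tuple_metric X d leq n "mean_dist n d"
      using tuple_metric_mean[OF \<open>n > 0\<close>] .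
    have "mean.tuples.order_contraction \<phi> (star_map n star F)"
      using contr unfolding mean.tuples.order_contraction_def by (simp add: mean_dist_def)
    then show ?thesis
      using mean.star_fixed_point_exists[OF FE assms(4-7) i ii x0 phi] by blast
  next
    fix \<phi> assume phi: "\<phi> \<in> Omega" and contr:
      "\<forall>x \<in> {1..n} \<rightarrow>\<^sub>E X. \<forall>y \<in> {1..n} \<rightarrow>\<^sub>E X. tuple_leq n x y \<or> tuple_leq n y x \<longrightarrow>
          (MAX i\<in>{1..n}. d (F (star_tuple n star x i)) (F (star_tuple n star y i)))
            \<le> \<phi> (MAX i\<in>{1..n}. d (x i) (y i))"
    interpret max: tuple_metric X d leq n "max_dist n d"
      using tuple_metric_max[OF \<open>n > 0\<close>] .
    have "max.tuples.order_contraction \<phi> (star_map n star F)"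
      using contr unfolding max.tuples.order_contraction_def by (simp add: max_dist_def)
    then show ?thesis
      using max.star_fixed_point_exists[OF FE assms(4-7) i ii x0 phi] by blast
  qed
qed

end
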